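(* Let $G=(M,d)$ be a metric graph that contains a theta, and suppose that every edge (metric segment) of $G$ has length at least $1$. Then there exist a set $B\subseteq M$ of three points and a set $R\subseteq M$ of three points such that \[ \sum_{\{x,y\} \subseteq R,\ x\neq y} d(x,y) + \sum_{\{x,y\}\subseteq B,\ x\neq y} d(x,y) - \sum_{x \in R,\, y \in B} d(x,y) \geq \frac{1}{12}.\] (The first two sums run over unordered pairs of distinct points.)
   Context: A metric segment of length $\ell>0$ is a metric space isometric to the real interval $[0,\ell]$. A metric graph $G=(M,d)$ is obtained by gluing a disjoint union of finitely many metric segments $E$ and points $V$ via an equivalence relation $R$ on the endpoints of the segments and the elements of $V$, where each equivalence class of $R$ contains exactly one element of $V$; $E$ is the set of edges and $V$ the set of vertices. The metric $d$ is the largest metric bounded above by the metric of each segment and by the function that is $0$ on $R$-equivalent pairs and $+\infty$ otherwise. A theta is the metric graph with two vertices and three metric segments, each having one endpoint identified with each of the two vertices. A metric graph contains a theta if some subset of its points, with the restricted metric, is isometric to a theta (i.e. there is a distance-preserving map from some theta into it). *)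

theory Defs
  imports "HOL-Analysis.Analysis"
begin

text \<open>
  The pieces that are glued: isolated points \<open>Vertex v\<close>, and for each edge \<open>e\<close> a metric segment,
  realised as \<open>{OnEdge e t | 0 \<le> t \<le> len e}\<close> with the metric of the real interval \<open>{0..len e}\<close>.
\<close>

datatype ('v, 'e) site = Vertex 'v | OnEdge 'e real

definition sites :: "'v set \<Rightarrow> 'e set \<Rightarrow> ('e \<Rightarrow> real) \<Rightarrow> ('v, 'e) site set" where
  "sites V E len = Vertex ` V \<union> {OnEdge e t | e t. e \<in> E \<and> 0 \<le> t \<and> t \<le> len e}"

definition endpoints :: "('e \<Rightarrow> real) \<Rightarrow> 'e \<Rightarrow> ('v, 'e) site set" where
  "endpoints len e = {OnEdge e 0, OnEdge e (len e)}"

definition gluing_sites :: "'v set \<Rightarrow> 'e set \<Rightarrow> ('e \<Rightarrow> real) \<Rightarrow> ('v, 'e) site set" where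
  "gluing_sites V E len = Vertex ` V \<union> (\<Union>e\<in>E. endpoints len e)"

text \<open>
  The relation \<open>R\<close> lives on \<open>gluing_sites\<close> only; \<open>Id\<close> extends it trivially to interior points
  of the segments.
\<close>

definition point_of :: "('v, 'e) site rel \<Rightarrow> ('v, 'e) site \<Rightarrow> ('v, 'e) site set" where
  "point_of R p = (R \<union> Id) `` {p}"

definition graph_points ::
  "'v set \<Rightarrow> 'e set \<Rightarrow> ('e \<Rightarrow> real) \<Rightarrow> ('v, 'e) site rel \<Rightarrow> ('v, 'e) site set set" where
  "graph_points V E len R = point_of R ` sites V E len"

text \<open>
  A metric on the quotient, pulled back to the disjoint union, vanishes on \<open>R\<close>-equivalent pairs,
  so the bound by the function that is 0 on those pairs and infinite elsewhere is built in.
\<close>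

definition bounded_metric ::
  "'v set \<Rightarrow> 'e set \<Rightarrow> ('e \<Rightarrow> real) \<Rightarrow> ('v, 'e) site rel
    \<Rightarrow> (('v, 'e) site set \<Rightarrow> ('v, 'e) site set \<Rightarrow> real) \<Rightarrow> bool" where
  "bounded_metric V E len R d \<longleftrightarrow>
     Metric_space (graph_points V E len R) d \<and>
     (\<forall>e\<in>E. \<forall>s\<in>{0..len e}. \<forall>t\<in>{0..len e}.
        d (point_of R (OnEdge e s)) (point_of R (OnEdge e t)) \<le> \<bar>s - t\<bar>)"

text \<open>
  Metrics are real valued, so the existence of a largest one in \<open>largest\<close> forces the graph to be
  connected. Loops and parallel edges are allowed.
\<close>

locale metric_graph =
  fixes V :: "'v set" and E :: "'e set" and len :: "'e \<Rightarrow> real"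
    and R :: "('v, 'e) site rel"
    and d :: "('v, 'e) site set \<Rightarrow> ('v, 'e) site set \<Rightarrow> real"
  assumes finite_V: "finite V"
    and finite_E: "finite E"
    and len_pos: "e \<in> E \<Longrightarrow> 0 < len e"
    and equiv_R: "equiv (gluing_sites V E len) R"
    and one_vertex: "C \<in> gluing_sites V E len // R \<Longrightarrow> \<exists>!v. v \<in> V \<and> Vertex v \<in> C"
    and bounded: "bounded_metric V E len R d"
    and largest: "bounded_metric V E len R \<rho> \<Longrightarrow> x \<in> graph_points V E len R \<Longrightarrow>
      y \<in> graph_points V E len R \<Longrightarrow> \<rho> x y \<le> d x y"

text \<open>
  Every class of \<open>R\<close> has exactly one vertex, so in \<open>ends\<close> the two vertices are hit by different
  endpoints of \<open>e\<close>. The three edge lengths are arbitrary.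
\<close>

locale theta = metric_graph +
  assumes two_vertices: "card V = 2"
    and three_edges: "card E = 3"
    and ends: "e \<in> E \<Longrightarrow> v \<in> V \<Longrightarrow> \<exists>p \<in> endpoints len e. (p, Vertex v) \<in> R"

definition contains_theta :: "'a set \<Rightarrow> ('a \<Rightarrow> 'a \<Rightarrow> real) \<Rightarrow> bool" where
  "contains_theta M d \<longleftrightarrow>
     (\<exists>(V :: nat set) (E :: nat set) len R \<delta>. theta V E len R \<delta> \<and>
        (\<exists>f. f ` graph_points V E len R \<subseteq> M \<and>
          (\<forall>x \<in> graph_points V E len R. \<forall>y \<in> graph_points V E len R. d (f x) (f y) = \<delta> x y)))"

text \<open>Each unordered pair of distinct points is counted twice by the sum over ordered pairs.\<close>

definition sum_pairs :: "('a \<Rightarrow> 'a \<Rightarrow> real) \<Rightarrow> 'a set \<Rightarrow> real" where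
  "sum_pairs d S = (\<Sum>(x, y) \<in> {(x, y). x \<in> S \<and> y \<in> S \<and> x \<noteq> y}. d x y) / 2"

end

theory Submission
  imports Defs
begin

text \<open>
  Maximality of \<open>d\<close> means that every function which is 1-Lipschitz along each edge is 1-Lipschitz for
  \<open>d\<close>; this yields all lower bounds on distances, and the triangle inequality yields the upper ones.
  A branch point of the theta cannot lie inside an edge of \<open>G\<close>, because an interval contains no
  tripod. So the two branch points are distinct vertices of \<open>G\<close>, at distance at least 1, and all arcs
  of the theta have length at least 1. If the arcs have lengths \<open>a \<le> b, c\<close>, let Blue consist of the
  three midpoints and Red of the points at positions \<open>a/4\<close>, \<open>(b - a)/2\<close>, \<open>(c + a)/2\<close> along the
  three arcs, all measured from the same branch point; the sum is then at least \<open>a/4\<close>.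
\<close>

section \<open>Lower bounds for distances in a metric graph, from Lipschitz functions\<close>

context metric_graph
begin

lemma metric: "Metric_space (graph_points V E len R) d"
  using bounded by (simp add: bounded_metric_def)

lemma edge_dist_le:
  "\<lbrakk>e \<in> E; s \<in> {0..len e}; t \<in> {0..len e}\<rbrakk> \<Longrightarrow>
    d (point_of R (OnEdge e s)) (point_of R (OnEdge e t)) \<le> \<bar>s - t\<bar>"
  using bounded by (auto simp: bounded_metric_def)

lemma R_sym: "(p, q) \<in> R \<Longrightarrow> (q, p) \<in> R"
  using equiv_R by (meson equivE symD)

lemma R_trans: "(p, q) \<in> R \<Longrightarrow> (q, r) \<in> R \<Longrightarrow> (p, r) \<in> R"
  using equiv_R by (meson equivE transD)

lemma R_refl: "p \<in> gluing_sites V E len \<Longrightarrow> (p, p) \<in> R"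
  using equiv_R by (meson equivE refl_onD)

lemma R_gluing_sites: "(p, q) \<in> R \<Longrightarrow> p \<in> gluing_sites V E len \<and> q \<in> gluing_sites V E len"
  using equiv_R by (metis equiv_class_eq_iff)

lemma point_of_eq:
  assumes "(p, q) \<in> R"
  shows "point_of R p = point_of R q"
proof -
  have "R `` {p} = R `` {q}" "q \<in> R `` {p}" "p \<in> R `` {q}"
    using equiv_class_eq[OF equiv_R assms] assms R_sym by auto
  then show ?thesis by (auto simp: point_of_def)
qed

lemma edge_site: "e \<in> E \<Longrightarrow> t \<in> {0..len e} \<Longrightarrow> OnEdge e t \<in> sites V E len"
  by (auto simp: sites_def)

lemma edge_point: "e \<in> E \<Longrightarrow> t \<in> {0..len e} \<Longrightarrow> point_of R (OnEdge e t) \<in> graph_points V E len R"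
  by (simp add: edge_site graph_points_def)

lemma gluing_site_vertex:
  assumes "p \<in> gluing_sites V E len"
  obtains v where "v \<in> V" "(p, Vertex v) \<in> R"
proof -
  have "R `` {p} \<in> gluing_sites V E len // R"
    using assms by (rule quotientI)
  from one_vertex[OF this] show thesis
    using that by auto
qed

lemma vertex_inj:
  assumes "v \<in> V" "w \<in> V" "(Vertex v, Vertex w) \<in> R"
  shows "v = w"
proof -
  have "R `` {Vertex v} \<in> gluing_sites V E len // R"
    using assms(1) by (intro quotientI) (auto simp: gluing_sites_def)
  from one_vertex[OF this] show ?thesis
    using assms R_refl[of "Vertex v"] by (auto simp: gluing_sites_def)
qed

text \<open>The function \<open>h\<close> descends to the quotient, and enlarging \<open>d\<close>
  by the pseudometric it induces there gives another metric bounded along every edge, which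
  \<open>largest\<close> compares with \<open>d\<close>.\<close>

lemma lipschitz_le_dist:
  fixes h :: "('v, 'e) site \<Rightarrow> real"
  assumes resp: "\<And>p q. (p, q) \<in> R \<Longrightarrow> h p = h q"
    and lip: "\<And>e s t. \<lbrakk>e \<in> E; s \<in> {0..len e}; t \<in> {0..len e}\<rbrakk> \<Longrightarrow>
      \<bar>h (OnEdge e s) - h (OnEdge e t)\<bar> \<le> \<bar>s - t\<bar>"
    and p: "p \<in> sites V E len" and q: "q \<in> sites V E len"
  shows "\<bar>h p - h q\<bar> \<le> d (point_of R p) (point_of R q)"
proof -
  interpret Metric_space "graph_points V E len R" d by (rule metric)
  \<comment> \<open>By \<open>resp\<close> the value does not depend on the chosen representative,
    so \<open>F\<close> is \<open>h\<close> on the quotient.\<close>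
  define F where "F X = h (SOME p. p \<in> X)" for X
  have F: "F (point_of R p) = h p" for p
  proof -
    have "p \<in> point_of R p" by (simp add: point_of_def)
    then have "(SOME q. q \<in> point_of R p) \<in> point_of R p" by (rule someI)
    then show ?thesis unfolding F_def
      using resp by (force simp: point_of_def)
  qed
  \<comment> \<open>The pseudometric from \<open>F\<close> need not separate points; the maximum
    with \<open>d\<close> does.\<close>
  define \<rho> where "\<rho> x y = max (d x y) \<bar>F x - F y\<bar>" for x y
  have "Metric_space (graph_points V E len R) \<rho>"
  proof
    fix x y z
    show "0 \<le> \<rho> x y" by (simp add: \<rho>_def le_max_iff_disj)
    show "\<rho> x y = \<rho> y x" by (simp add: \<rho>_def commute abs_minus_commute)
    assume "x \<in> graph_points V E len R" "y \<in> graph_points V E len R"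
    show "\<rho> x y = 0 \<longleftrightarrow> x = y"
    proof
      assume "\<rho> x y = 0"
      then have "d x y \<le> 0" by (auto simp: \<rho>_def)
      then show "x = y"
        using \<open>x \<in> _\<close> \<open>y \<in> _\<close> nonneg[of x y] by simp
    next
      assume "x = y"
      then show "\<rho> x y = 0" using \<open>x \<in> _\<close> by (simp add: \<rho>_def)
    qed
    assume "z \<in> graph_points V E len R"
    show "\<rho> x z \<le> \<rho> x y + \<rho> y z"
      using triangle[OF \<open>x \<in> _\<close> \<open>y \<in> _\<close> \<open>z \<in> _\<close>] by (auto simp: \<rho>_def)
  qed
  then have "bounded_metric V E len R \<rho>"
    using bounded lip by (auto simp: bounded_metric_def \<rho>_def F)
  from largest[OF this] have "\<rho> (point_of R p) (point_of R q) \<le> d (point_of R p) (point_of R q)"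
    using p q by (simp add: graph_points_def)
  then show ?thesis by (simp add: \<rho>_def F)
qed

text \<open>The test function is the distance to \<open>v\<close> inside the graph, truncated at
  \<open>l\<close>. Truncation gives all other vertices the same value \<open>l\<close>, so no
  shortest path has to be found.\<close>

lemma vertex_dist_ge:
  assumes len: "\<And>e. e \<in> E \<Longrightarrow> l \<le> len e" and l: "0 \<le> l"
    and v: "v \<in> V" and w: "w \<in> V" and "v \<noteq> w"
  shows "l \<le> d (point_of R (Vertex v)) (point_of R (Vertex w))"
proof -
  define \<phi> where "\<phi> p = (if (p, Vertex v) \<in> R then 0 else l)" for p
  define h where "h p = (case p of Vertex x \<Rightarrow> \<phi> p
    | OnEdge e t \<Rightarrow> min l (min (\<phi> (OnEdge e 0) + t) (\<phi> (OnEdge e (len e)) + len e - t)))" for p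
  have \<phi>_bounds: "0 \<le> \<phi> p \<and> \<phi> p \<le> l" for p
    using l by (simp add: \<phi>_def)
  \<comment> \<open>At one end of an edge the term coming from the other end is at least
    \<open>len e\<close>, hence at least \<open>l\<close>, so it never undercuts
    \<open>\<phi>\<close>.\<close>
  have h: "h p = \<phi> p" if "p \<in> gluing_sites V E len" for p
  proof (cases p)
    case (OnEdge e t)
    then have e: "e \<in> E" and t: "t = 0 \<or> t = len e"
      using that by (auto simp: gluing_sites_def endpoints_def)
    then show ?thesis
      using len[OF e] \<phi>_bounds[of "OnEdge e 0"] \<phi>_bounds[of "OnEdge e (len e)"] l
      by (auto simp: OnEdge h_def)
  qed (simp add: h_def)
  have "\<bar>h (Vertex v) - h (Vertex w)\<bar> \<le> d (point_of R (Vertex v)) (point_of R (Vertex w))"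
  proof (rule lipschitz_le_dist)
    fix p q assume pq: "(p, q) \<in> R"
    then have "(p, Vertex v) \<in> R \<longleftrightarrow> (q, Vertex v) \<in> R" by (meson R_sym R_trans)
    then have "\<phi> p = \<phi> q" by (simp add: \<phi>_def)
    then show "h p = h q" using R_gluing_sites[OF pq] h by simp
  next
    fix e s t
    show "\<bar>h (OnEdge e s) - h (OnEdge e t)\<bar> \<le> \<bar>s - t\<bar>" by (auto simp: h_def)
  qed (use v w in \<open>auto simp: sites_def\<close>)
  moreover have "h (Vertex v) = 0" "h (Vertex w) = l"
    using R_refl[of "Vertex v"] v w vertex_inj[OF w v] \<open>v \<noteq> w\<close>
    by (auto simp: h_def \<phi>_def gluing_sites_def)
  ultimately show ?thesis by simp
qed

text \<open>A tent of height \<open>\<epsilon>\<close> centred at \<open>\<tau>\<close> fits inside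
  the edge, so it vanishes at all gluing sites and extends by zero to a Lipschitz function. A point
  closer than \<open>\<epsilon>\<close> sees a positive value, so it lies on \<open>e\<close>, and
  the drop in height measures its offset from \<open>\<tau>\<close>.\<close>

lemma interior_neighbourhood:
  assumes e: "e \<in> E" and \<epsilon>: "\<epsilon> \<le> \<tau>" "\<tau> + \<epsilon> \<le> len e"
    and x: "x \<in> graph_points V E len R"
    and dist: "d (point_of R (OnEdge e \<tau>)) x < \<epsilon>"
  obtains t where "t \<in> {0..len e}" "x = point_of R (OnEdge e t)"
    "\<bar>t - \<tau>\<bar> \<le> d (point_of R (OnEdge e \<tau>)) x"
proof -
  interpret Metric_space "graph_points V E len R" d by (rule metric)
  have "0 < \<epsilon>" using dist nonneg order_le_less_trans by blast
  define h where "h p = (case p of Vertex x \<Rightarrow> 0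
    | OnEdge e' t \<Rightarrow> if e' = e then max 0 (\<epsilon> - \<bar>t - \<tau>\<bar>) else 0)" for p :: "('v, 'e) site"
  have h0: "h p = 0" if "p \<in> gluing_sites V E len" for p
    using that \<epsilon> by (auto simp: gluing_sites_def endpoints_def h_def)
  obtain q where q: "q \<in> sites V E len" "x = point_of R q"
    using x by (auto simp: graph_points_def)
  have le: "\<bar>h (OnEdge e \<tau>) - h q\<bar> \<le> d (point_of R (OnEdge e \<tau>)) x"
    unfolding q
  proof (rule lipschitz_le_dist)
    fix p q assume "(p, q) \<in> R"
    then show "h p = h q" using R_gluing_sites h0 by metis
  next
    fix e s t
    show "\<bar>h (OnEdge e s) - h (OnEdge e t)\<bar> \<le> \<bar>s - t\<bar>" by (auto simp: h_def)
  qed (use e q \<epsilon> \<open>0 < \<epsilon>\<close> in \<open>auto intro: edge_site\<close>)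
  have "h (OnEdge e \<tau>) = \<epsilon>" using \<open>0 < \<epsilon>\<close> by (simp add: h_def)
  with le dist have "0 < h q" by linarith
  then obtain t where t: "q = OnEdge e t"
    by (auto simp: h_def split: site.splits if_splits)
  show thesis
  proof
    show "t \<in> {0..len e}" using q t by (auto simp: sites_def)
    show "x = point_of R (OnEdge e t)" using q t by simp
    show "\<bar>t - \<tau>\<bar> \<le> d (point_of R (OnEdge e \<tau>)) x"
      using le \<open>0 < h q\<close> \<open>h (OnEdge e \<tau>) = \<epsilon>\<close> by (auto simp: h_def t)
  qed
qed

end

section \<open>Parallel arcs in a metric space\<close>

text \<open>
  The arcs \<open>P e\<close> all run from one common point to another. Assumption \<open>lipschitz\<close> records that \<open>d\<close> is
  at least the intrinsic metric of their union; unlike the construction by gluing, it is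
  preserved under isometric embeddings.
\<close>

locale parallel_arcs = Metric_space M d for M :: "'a set" and d +
  fixes E :: "'e set" and len :: "'e \<Rightarrow> real" and P :: "'e \<Rightarrow> real \<Rightarrow> 'a"
  assumes len_pos: "e \<in> E \<Longrightarrow> 0 < len e"
    and in_space: "e \<in> E \<Longrightarrow> t \<in> {0..len e} \<Longrightarrow> P e t \<in> M"
    and arc_dist_le: "\<lbrakk>e \<in> E; s \<in> {0..len e}; t \<in> {0..len e}\<rbrakk> \<Longrightarrow> d (P e s) (P e t) \<le> \<bar>s - t\<bar>"
    and common_start: "e \<in> E \<Longrightarrow> e' \<in> E \<Longrightarrow> P e 0 = P e' 0"
    and common_end: "e \<in> E \<Longrightarrow> e' \<in> E \<Longrightarrow> P e (len e) = P e' (len e')"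
    and lipschitz: "\<lbrakk>\<And>e. e \<in> E \<Longrightarrow> g e 0 = p; \<And>e. e \<in> E \<Longrightarrow> g e (len e) = q;
        \<And>e s t. \<lbrakk>e \<in> E; s \<in> {0..len e}; t \<in> {0..len e}\<rbrakk> \<Longrightarrow> \<bar>g e s - g e t\<bar> \<le> \<bar>s - t\<bar>;
        e \<in> E; e' \<in> E; s \<in> {0..len e}; t \<in> {0..len e'}\<rbrakk>
      \<Longrightarrow> \<bar>g e s - g e' t :: real\<bar> \<le> d (P e s) (P e' t)"
begin

text \<open>This symmetry transfers every statement about the common start to the common
  end.\<close>

lemma reverse: "parallel_arcs M d E len (\<lambda>e t. P e (len e - t))"
proof unfold_locales
  fix g :: "'e \<Rightarrow> real \<Rightarrow> real" and p q e e' s t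
  assume g0: "\<And>e. e \<in> E \<Longrightarrow> g e 0 = p" and g1: "\<And>e. e \<in> E \<Longrightarrow> g e (len e) = q"
    and lip: "\<And>e s t. \<lbrakk>e \<in> E; s \<in> {0..len e}; t \<in> {0..len e}\<rbrakk> \<Longrightarrow> \<bar>g e s - g e t\<bar> \<le> \<bar>s - t\<bar>"
    and *: "e \<in> E" "e' \<in> E" "s \<in> {0..len e}" "t \<in> {0..len e'}"
  have "\<bar>g e (len e - (len e - s)) - g e' (len e' - (len e' - t))\<bar>
      \<le> d (P e (len e - s)) (P e' (len e' - t))"
  proof (rule lipschitz[where g = "\<lambda>e t. g e (len e - t)" and p = q and q = p])
    fix x r r' assume "x \<in> E" "r \<in> {0..len x}" "r' \<in> {0..len x}"
    then show "\<bar>g x (len x - r) - g x (len x - r')\<bar> \<le> \<bar>r - r'\<bar>"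
      using lip[of x "len x - r" "len x - r'"] by auto
  qed (use g0 g1 * in auto)
  then show "\<bar>g e s - g e' t\<bar> \<le> d (P e (len e - s)) (P e' (len e' - t))" by simp
next
  fix e s t
  assume *: "e \<in> E" "s \<in> {0..len e}" "t \<in> {0..len e}"
  show "d (P e (len e - s)) (P e (len e - t)) \<le> \<bar>s - t\<bar>"
    using arc_dist_le[of e "len e - s" "len e - t"] * by auto
next
  fix e e' assume e: "e \<in> E" "e' \<in> E"
  show "P e (len e - 0) = P e' (len e' - 0)" "P e (len e - len e) = P e' (len e' - len e')"
    using common_end[OF e] common_start[OF e] by simp_all
qed (auto intro: len_pos in_space)

lemma dist_le_via_start:
  assumes "e \<in> E" "e' \<in> E" "s \<in> {0..len e}" "t \<in> {0..len e'}"
  shows "d (P e s) (P e' t) \<le> s + t"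
proof -
  have "d (P e s) (P e' t) \<le> d (P e s) (P e 0) + d (P e 0) (P e' t)"
    using assms by (intro triangle in_space) auto
  also have "\<dots> \<le> s + t"
    using arc_dist_le[of e s 0] arc_dist_le[of e' 0 t] common_start[of e e'] assms by auto
  finally show ?thesis .
qed

lemma dist_le_via_end:
  assumes "e \<in> E" "e' \<in> E" "s \<in> {0..len e}" "t \<in> {0..len e'}"
  shows "d (P e s) (P e' t) \<le> (len e - s) + (len e' - t)"
  using parallel_arcs.dist_le_via_start[OF reverse, of e e' "len e - s" "len e' - t"] assms by auto

text \<open>Opposite tents over \<open>{0..2 * \<eta>}\<close> on the two arcs vanish at both branch
  points and differ by \<open>2 * \<eta>\<close> at their peaks. Three arcs thus leave the start in
  separate directions, which no interval can accommodate.\<close>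

lemma tripod:
  assumes "e \<in> E" "e' \<in> E" "e \<noteq> e'" "0 \<le> \<eta>" "2 * \<eta> \<le> len e" "2 * \<eta> \<le> len e'"
  shows "2 * \<eta> \<le> d (P e \<eta>) (P e' \<eta>)"
proof -
  define g where "g x t = (if x = e then max 0 (\<eta> - \<bar>t - \<eta>\<bar>)
    else if x = e' then - max 0 (\<eta> - \<bar>t - \<eta>\<bar>) else 0)" for x t
  have "\<bar>g e \<eta> - g e' \<eta>\<bar> \<le> d (P e \<eta>) (P e' \<eta>)"
    by (rule lipschitz[where p = 0 and q = 0]) (use assms in \<open>auto simp: g_def\<close>)
  then show ?thesis using assms by (simp add: g_def)
qed

text \<open>The arc parameter, truncated at the shortest arc length \<open>m\<close>, is a common
  Lipschitz function with value \<open>0\<close> at the start and \<open>m\<close> at the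
  end.\<close>

lemma start_neq_end:
  assumes "finite E" "e \<in> E"
  shows "P e 0 \<noteq> P e (len e)"
proof
  assume eq: "P e 0 = P e (len e)"
  define m where "m = Min (len ` E)"
  have "\<bar>min 0 m - min (len e) m\<bar> \<le> d (P e 0) (P e (len e))"
    by (rule lipschitz[where g = "\<lambda>e t. min t m" and p = "min 0 m" and q = m])
       (use assms len_pos[OF assms(2)] in \<open>auto simp: m_def intro!: min.absorb2\<close>)
  moreover have "E \<noteq> {}" using assms by blast
  then have "0 < m" "m \<le> len e" using assms len_pos by (simp_all add: m_def)
  moreover have "d (P e (len e)) (P e (len e)) = 0"
    using assms len_pos[OF assms(2)] by (simp add: in_space)
  ultimately show False using eq by simp
qed

text \<open>
  The assumption on \<open>s\<close> says that no geodesic from \<open>P e s\<close> to a branch point has to pass through the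
  other one.
\<close>

lemma dist_ge:
  assumes e: "e \<in> E" "e' \<in> E" "e \<noteq> e'" "s \<in> {0..len e}" "t \<in> {0..len e'}"
    and bal: "\<And>x. x \<in> E \<Longrightarrow> \<bar>len e - 2 * s\<bar> \<le> len x"
    and r: "r \<le> s + t" "r \<le> (len e - s) + (len e' - t)"
  shows "r \<le> d (P e s) (P e' t)"
proof -
  \<comment> \<open>This is the intrinsic distance from \<open>P e s\<close> to
    \<open>P x r\<close>. By \<open>bal\<close> the formulas for \<open>x = e\<close> and
    \<open>x \<noteq> e\<close> agree at both branch points.\<close>
  define g where "g x r = (if x = e then \<bar>r - s\<bar>
    else min (s + r) ((len e - s) + (len x - r)))" for x r
  have "\<bar>g e s - g e' t\<bar> \<le> d (P e s) (P e' t)"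
  proof (rule lipschitz)
    show "g x 0 = s" if "x \<in> E" for x using bal[OF that] e by (auto simp: g_def)
    show "g x (len x) = len e - s" if "x \<in> E" for x using bal[OF that] e by (auto simp: g_def)
    show "\<bar>g x r - g x r'\<bar> \<le> \<bar>r - r'\<bar>" for x r r' by (auto simp: g_def)
  qed (use e in auto)
  then show ?thesis using e r by (auto simp: g_def)
qed

end

section \<open>Three red and three blue points on three arcs\<close>

lemma sum_pairs_3:
  assumes "x \<noteq> y" "x \<noteq> z" "y \<noteq> z" and "\<And>x y. d x y = d y x"
  shows "sum_pairs d {x, y, z} = d x y + d x z + d y z"
proof -
  have "{(a, b). a \<in> {x, y, z} \<and> b \<in> {x, y, z} \<and> a \<noteq> b} =
    {(x, y), (y, x), (x, z), (z, x), (y, z), (z, y)}"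
    using assms by auto
  then have "sum_pairs d {x, y, z} = (\<Sum>(a, b)\<in>{(x, y), (y, x), (x, z), (z, x), (y, z), (z, y)}. d a b) / 2"
    by (simp only: sum_pairs_def)
  also have "\<dots> = d x y + d x z + d y z"
    using assms(1-3) assms(4)[of y x] assms(4)[of z x] assms(4)[of z y] by auto
  finally show ?thesis .
qed

context parallel_arcs
begin

text \<open>With lengths \<open>a\<close>, \<open>b\<close>, \<open>c\<close>, the lower bounds for
  pairs of equal colour add up to \<open>a + 2 * b + 2 * c\<close>, and the upper bounds for the
  nine mixed pairs to \<open>3 * a / 4 + 2 * b + 2 * c\<close>. The difference is
  \<open>a / 4\<close>.\<close>

lemma six_points:
  assumes E: "e1 \<in> E" "e2 \<in> E" "e3 \<in> E" "e1 \<noteq> e2" "e1 \<noteq> e3" "e2 \<noteq> e3"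
    and min: "\<And>x. x \<in> E \<Longrightarrow> len e1 \<le> len x"
  shows "\<exists>Blue Red. Blue \<subseteq> M \<and> Red \<subseteq> M \<and> card Blue = 3 \<and> card Red = 3 \<and>
    sum_pairs d Red + sum_pairs d Blue - (\<Sum>x\<in>Red. \<Sum>y\<in>Blue. d x y) \<ge> len e1 / 4"
proof -
  define a b c where abc: "a = len e1" "b = len e2" "c = len e3"
  have pos: "0 < a" "a \<le> b" "a \<le> c" using E min len_pos by (auto simp: abc)
  define w u v where "w = P e1 (a / 4)" "u = P e2 ((b - a) / 2)" "v = P e3 ((c + a) / 2)"
  define x y z where "x = P e1 (a / 2)" "y = P e2 (b / 2)" "z = P e3 (c / 2)"
  note pts = w_u_v_def x_y_z_def
  \<comment> \<open>Every pair of equal colour is measured from one of \<open>w\<close>,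
    \<open>u\<close>, \<open>x\<close>, \<open>y\<close>, so \<open>dist_ge\<close> asks for balance
    at these four points.\<close>
  have bal: "\<bar>len e1 - 2 * (a / 4)\<bar> \<le> len e" "\<bar>len e2 - 2 * ((b - a) / 2)\<bar> \<le> len e"
    "\<bar>len e1 - 2 * (a / 2)\<bar> \<le> len e" "\<bar>len e2 - 2 * (b / 2)\<bar> \<le> len e" if "e \<in> E" for e
    using min[OF that] pos by (auto simp flip: abc simp: field_simps)
  have mem: "w \<in> M" "u \<in> M" "v \<in> M" "x \<in> M" "y \<in> M" "z \<in> M"
    unfolding pts using E pos by (auto intro!: in_space simp flip: abc)
  have low: "a / 4 + (b - a) / 2 \<le> d w u" "3 * a / 4 + (c - a) / 2 \<le> d w v"
    "(b - a) / 2 + (c + a) / 2 \<le> d u v" "a / 2 + b / 2 \<le> d x y" "a / 2 + c / 2 \<le> d x z"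
    "b / 2 + c / 2 \<le> d y z"
  proof -
show "a / 4 + (b - a) / 2 \<le> d w u"
      unfolding pts by (rule dist_ge[OF E(1,2,4) _ _ bal(1)]) (use pos in \<open>auto simp: field_simps simp flip: abc\<close>)
    show "3 * a / 4 + (c - a) / 2 \<le> d w v"
      unfolding pts by (rule dist_ge[OF E(1,3,5) _ _ bal(1)]) (use pos in \<open>auto simp: field_simps simp flip: abc\<close>)
    show "(b - a) / 2 + (c + a) / 2 \<le> d u v"
      unfolding pts by (rule dist_ge[OF E(2,3,6) _ _ bal(2)]) (use pos in \<open>auto simp: field_simps simp flip: abc\<close>)
    show "a / 2 + b / 2 \<le> d x y"
      unfolding pts by (rule dist_ge[OF E(1,2,4) _ _ bal(3)]) (use pos in \<open>auto simp: field_simps simp flip: abc\<close>)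
    show "a / 2 + c / 2 \<le> d x z"
      unfolding pts by (rule dist_ge[OF E(1,3,5) _ _ bal(3)]) (use pos in \<open>auto simp: field_simps simp flip: abc\<close>)
    show "b / 2 + c / 2 \<le> d y z"
      unfolding pts by (rule dist_ge[OF E(2,3,6) _ _ bal(4)]) (use pos in \<open>auto simp: field_simps simp flip: abc\<close>)
  qed
  have up1: "d w x \<le> a / 4" "d u y \<le> a / 2" "d v z \<le> a / 2"
    unfolding pts
    using arc_dist_le[of e1 "a / 4" "a / 2"] arc_dist_le[of e2 "(b - a) / 2" "b / 2"]
      arc_dist_le[of e3 "(c + a) / 2" "c / 2"] E pos
    by (auto simp: field_simps simp flip: abc)
  \<comment> \<open>The paths from \<open>w\<close> and \<open>u\<close> to other arcs run through
    the start; those from \<open>v\<close>, which lies beyond the midpoint of its arc, run through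
    the end.\<close>
  have up2: "d w y \<le> a / 4 + b / 2" "d w z \<le> a / 4 + c / 2" "d u x \<le> (b - a) / 2 + a / 2"
    "d u z \<le> (b - a) / 2 + c / 2" "d v x \<le> (c - a) / 2 + a / 2" "d v y \<le> (c - a) / 2 + b / 2"
    unfolding pts
    using dist_le_via_start[of e1 e2 "a / 4" "b / 2"] dist_le_via_start[of e1 e3 "a / 4" "c / 2"]
      dist_le_via_start[of e2 e1 "(b - a) / 2" "a / 2"]
      dist_le_via_start[of e2 e3 "(b - a) / 2" "c / 2"]
      dist_le_via_end[of e3 e1 "(c + a) / 2" "a / 2"]
      dist_le_via_end[of e3 e2 "(c + a) / 2" "b / 2"] E pos
    by (auto simp: field_simps simp flip: abc)
  \<comment> \<open>The lower bounds are positive, so points of equal colour are distinct.\<close>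
  have neq: "w \<noteq> u" "w \<noteq> v" "u \<noteq> v" "x \<noteq> y" "x \<noteq> z" "y \<noteq> z"
    using low pos mem by (auto simp: field_simps)
  have "a / 4 \<le> sum_pairs d {w, u, v} + sum_pairs d {x, y, z}
      - (\<Sum>p\<in>{w, u, v}. \<Sum>q\<in>{x, y, z}. d p q)"
    using neq low up1 up2
    by (simp add: sum_pairs_3 commute) (simp add: field_simps)
  moreover have "card {x, y, z} = 3" "card {w, u, v} = 3" using neq by auto
  ultimately show ?thesis
    using mem by (intro exI[of _ "{x, y, z}"] exI[of _ "{w, u, v}"]) (auto simp: abc)
qed

end

section \<open>From a contained theta to parallel arcs\<close>

text \<open>After orienting all segments from \<open>u\<close> to \<open>v\<close>, functions on the
  arcs with common end values are functions on the glued space, so \<open>lipschitz\<close> reduces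
  to \<open>lipschitz_le_dist\<close>.\<close>

lemma (in theta) parallel_arcs:
  obtains P where "parallel_arcs (graph_points V E len R) d E len P"
proof -
  obtain u v where V: "V = {u, v}" "u \<noteq> v"
    using two_vertices by (auto simp: card_2_iff)
  \<comment> \<open>The segments may be glued in either direction; \<open>flip e\<close> is an
    involution that makes parameter \<open>0\<close> correspond to \<open>u\<close>.\<close>
  define flip where "flip e t = (if (OnEdge e 0, Vertex u) \<in> R then t else len e - t)" for e t
  define P where "P e t = point_of R (OnEdge e (flip e t))" for e t
  have flip_range: "flip e t \<in> {0..len e}" if "t \<in> {0..len e}" for e t
    using that by (auto simp: flip_def)
  have flip_flip: "flip e (flip e t) = t" for e t
    by (simp add: flip_def)
  have uv: "(Vertex u, Vertex v) \<notin> R"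
    using vertex_inj[of u v] V by auto
  have ends': "(OnEdge e (flip e 0), Vertex u) \<in> R" "(OnEdge e (flip e (len e)), Vertex v) \<in> R"
    if e: "e \<in> E" for e
  proof -
    obtain x y where "x \<in> endpoints len e" "(x, Vertex u) \<in> R" "y \<in> endpoints len e" "(y, Vertex v) \<in> R"
      using ends[OF e, of u] ends[OF e, of v] V by auto
    moreover have "\<not> ((z, Vertex u) \<in> R \<and> (z, Vertex v) \<in> R)" for z
      using uv by (meson R_sym R_trans)
    ultimately show "(OnEdge e (flip e 0), Vertex u) \<in> R" "(OnEdge e (flip e (len e)), Vertex v) \<in> R"
      by (auto simp: flip_def endpoints_def)
  qed
  have "parallel_arcs (graph_points V E len R) d E len P"
    unfolding parallel_arcs_def parallel_arcs_axioms_def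
  proof (intro conjI allI impI)
    show "Metric_space (graph_points V E len R) d" by (rule metric)
  next
    fix g :: "'b \<Rightarrow> real \<Rightarrow> real" and p q e e' s t
    assume g0: "\<forall>e. e \<in> E \<longrightarrow> g e 0 = p" and g1: "\<forall>e. e \<in> E \<longrightarrow> g e (len e) = q"
      and lip: "\<forall>e s t. e \<in> E \<longrightarrow> s \<in> {0..len e} \<longrightarrow> t \<in> {0..len e} \<longrightarrow> \<bar>g e s - g e t\<bar> \<le> \<bar>s - t\<bar>"
      and e: "e \<in> E" "e' \<in> E" "s \<in> {0..len e}" "t \<in> {0..len e'}"
    define h where "h x = (case x of Vertex w \<Rightarrow> if w = u then p else q
      | OnEdge e t \<Rightarrow> g e (flip e t))" for x
    \<comment> \<open>Since each class contains a vertex, comparing a site with that vertex suffices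
      for the invariance of \<open>h\<close> under \<open>R\<close>.\<close>
    have h_vertex: "h x = h (Vertex w)" if "(x, Vertex w) \<in> R" "w \<in> V" for x w
    proof (cases x)
      case (Vertex y)
      then have "y \<in> V" using R_gluing_sites[OF that(1)] by (auto simp: gluing_sites_def endpoints_def)
      then show ?thesis using Vertex vertex_inj[of y w] that by auto
    next
      case (OnEdge e t)
      then have et: "e \<in> E" "t = 0 \<or> t = len e"
        using R_gluing_sites[OF that(1)] by (auto simp: gluing_sites_def endpoints_def)
      then have "t = flip e 0 \<or> t = flip e (len e)" by (auto simp: flip_def)
      then show ?thesis
      proof
        assume t: "t = flip e 0"
        have "(Vertex u, Vertex w) \<in> R"
          using ends'(1)[OF et(1)] that OnEdge t R_sym R_trans by blast
        then have "w = u" using vertex_inj that V by blast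
        then show ?thesis using OnEdge t flip_flip g0 et by (simp add: h_def)
      next
        assume t: "t = flip e (len e)"
        have "(Vertex v, Vertex w) \<in> R"
          using ends'(2)[OF et(1)] that OnEdge t R_sym R_trans by blast
        then have "w = v" using vertex_inj that V by blast
        then show ?thesis using OnEdge t flip_flip g1 et V by (simp add: h_def)
      qed
    qed
    have "\<bar>h (OnEdge e (flip e s)) - h (OnEdge e' (flip e' t))\<bar> \<le> d (P e s) (P e' t)"
      unfolding P_def
    proof (rule lipschitz_le_dist)
      fix x y assume xy: "(x, y) \<in> R"
      obtain w where "w \<in> V" "(y, Vertex w) \<in> R"
        using gluing_site_vertex R_gluing_sites[OF xy] by metis
      with xy show "h x = h y" using h_vertex R_trans by metis
    next
      fix e s t assume *: "e \<in> E" "s \<in> {0..len e}" "t \<in> {0..len e}"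
      have "\<bar>g e (flip e s) - g e (flip e t)\<bar> \<le> \<bar>flip e s - flip e t\<bar>"
        using lip * flip_range by blast
      then show "\<bar>h (OnEdge e s) - h (OnEdge e t)\<bar> \<le> \<bar>s - t\<bar>"
        by (simp add: h_def flip_def split: if_splits)
    qed (use e flip_range in \<open>auto intro!: edge_site\<close>)
    then show "\<bar>g e s - g e' t\<bar> \<le> d (P e s) (P e' t)" by (simp add: h_def flip_flip)
  next
    fix e s t assume *: "e \<in> E" "s \<in> {0..len e}" "t \<in> {0..len e}"
    have "d (P e s) (P e t) \<le> \<bar>flip e s - flip e t\<bar>"
      unfolding P_def using * flip_range by (intro edge_dist_le)
    then show "d (P e s) (P e t) \<le> \<bar>s - t\<bar>" by (simp add: flip_def split: if_splits)
  next
    fix e t assume "e \<in> E" "t \<in> {0..len e}"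
    then show "P e t \<in> graph_points V E len R"
      unfolding P_def by (intro edge_point flip_range)
  next
    fix e e' assume e: "e \<in> E" "e' \<in> E"
    show "P e 0 = P e' 0" "P e (len e) = P e' (len e')"
      using ends'[OF e(1)] ends'[OF e(2)] by (simp_all add: P_def point_of_eq)
  qed (rule len_pos)
  then show thesis by (rule that)
qed

lemma (in Metric_space) contains_theta_parallel_arcs:
  assumes "contains_theta M d"
  obtains E :: "nat set" and len P where "card E = 3" "parallel_arcs M d E len P"
proof -
  obtain V E :: "nat set" and len R \<delta> f where th: "theta V E len R \<delta>"
    and f: "f ` graph_points V E len R \<subseteq> M"
      "\<forall>x \<in> graph_points V E len R. \<forall>y \<in> graph_points V E len R. d (f x) (f y) = \<delta> x y"
    using assms unfolding contains_theta_def by (elim exE conjE)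
  obtain P where "parallel_arcs (graph_points V E len R) \<delta> E len P"
    using theta.parallel_arcs[OF th] .
  then interpret T: parallel_arcs "graph_points V E len R" \<delta> E len P .
  have "parallel_arcs M d E len (\<lambda>e t. f (P e t))"
  proof unfold_locales
    fix g :: "nat \<Rightarrow> real \<Rightarrow> real" and p q e e' s t
    assume g: "\<And>e. e \<in> E \<Longrightarrow> g e 0 = p" "\<And>e. e \<in> E \<Longrightarrow> g e (len e) = q"
      "\<And>e s t. \<lbrakk>e \<in> E; s \<in> {0..len e}; t \<in> {0..len e}\<rbrakk> \<Longrightarrow> \<bar>g e s - g e t\<bar> \<le> \<bar>s - t\<bar>"
      and e: "e \<in> E" "e' \<in> E" "s \<in> {0..len e}" "t \<in> {0..len e'}"
    have "\<bar>g e s - g e' t\<bar> \<le> \<delta> (P e s) (P e' t)"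
      by (rule T.lipschitz[where p = p and q = q]) (use g e in blast)+
    then show "\<bar>g e s - g e' t\<bar> \<le> d (f (P e s)) (f (P e' t))"
      using e by (simp add: f T.in_space)
  next
    fix e e' assume e: "e \<in> E" "e' \<in> E"
    show "f (P e 0) = f (P e' 0)" "f (P e (len e)) = f (P e' (len e'))"
      using T.common_start[OF e] T.common_end[OF e] by simp_all
  next
    fix e t assume "e \<in> E" "t \<in> {0..len e}"
    then show "f (P e t) \<in> M" using f(1) T.in_space by blast
  qed (auto simp: f T.in_space T.arc_dist_le T.len_pos)
  moreover have "card E = 3"
    using th by (simp add: theta_def theta_axioms_def)
  ultimately show thesis using that by blast
qed

section \<open>Branch points of an embedded theta\<close>

text \<open>If the branch point were interior to an edge, the points at parameter
  \<open>\<eta>\<close> on the three arcs would have edge parameters within \<open>\<eta>\<close> of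
  \<open>\<tau>\<close> but pairwise at least \<open>2 * \<eta>\<close> apart.\<close>

lemma (in metric_graph) branch_point_vertex:
  assumes arcs: "parallel_arcs (graph_points V E len R) d A l P"
    and A: "card A = 3" "k \<in> A"
  obtains v where "v \<in> V" "P k 0 = point_of R (Vertex v)"
proof (rule ccontr)
  assume contr: "\<not> thesis"
  interpret T: parallel_arcs "graph_points V E len R" d A l P by (rule arcs)
  have "finite A" using A by (simp add: card_ge_0_finite)
  have "P k 0 \<in> graph_points V E len R" using A T.len_pos[OF A(2)] by (intro T.in_space) auto
  then obtain x where x: "x \<in> sites V E len" "P k 0 = point_of R x"
    by (auto simp: graph_points_def)
  have "x \<notin> gluing_sites V E len"
  proof
    assume "x \<in> gluing_sites V E len"
    then obtain v where "v \<in> V" "(x, Vertex v) \<in> R" by (rule gluing_site_vertex)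
    then show False using contr that x(2) point_of_eq by metis
  qed
  with x obtain e \<tau> where e: "e \<in> E" and x': "x = OnEdge e \<tau>" and \<tau>: "0 < \<tau>" "\<tau> < len e"
    by (auto simp: sites_def gluing_sites_def endpoints_def less_le)
  \<comment> \<open>The radius \<open>\<epsilon>\<close> keeps the neighbourhood inside the edge.
    Halving gives \<open>\<eta>\<close> strictly below \<open>\<epsilon>\<close> for
    \<open>interior_neighbourhood\<close>, and \<open>2 * \<eta>\<close> at most every arc length
    for \<open>tripod\<close>.\<close>
  define \<epsilon> where "\<epsilon> = min \<tau> (len e - \<tau>)"
  define \<eta> where "\<eta> = min (\<epsilon> / 2) (Min (l ` A) / 2)"
  have "0 < Min (l ` A)" using A T.len_pos \<open>finite A\<close> by (subst Min_gr_iff) auto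
  moreover have "0 < \<epsilon>" using \<tau> by (simp add: \<epsilon>_def)
  ultimately have \<eta>: "0 < \<eta>" "\<eta> < \<epsilon>" by (simp_all add: \<eta>_def min_less_iff_disj)
  have \<eta>_len: "2 * \<eta> \<le> l i" if "i \<in> A" for i
  proof -
    have "Min (l ` A) \<le> l i" using that \<open>finite A\<close> by simp
    then show ?thesis by (auto simp: \<eta>_def)
  qed
  have "\<exists>t\<in>{0..len e}. P i \<eta> = point_of R (OnEdge e t) \<and> \<bar>t - \<tau>\<bar> \<le> \<eta>" if i: "i \<in> A" for i
  proof -
    have \<eta>i: "0 \<in> {0..l i}" "\<eta> \<in> {0..l i}" using \<eta> \<eta>_len[OF i] by auto
    have le: "d (point_of R (OnEdge e \<tau>)) (P i \<eta>) \<le> \<eta>"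
      using T.arc_dist_le[OF i \<eta>i] T.common_start[OF i A(2)] \<eta> x x' by simp
    have "\<epsilon> \<le> \<tau>" "\<tau> + \<epsilon> \<le> len e" "d (point_of R (OnEdge e \<tau>)) (P i \<eta>) < \<epsilon>"
      using le \<eta> by (simp_all add: \<epsilon>_def)
    then obtain t where "t \<in> {0..len e}" "P i \<eta> = point_of R (OnEdge e t)"
      "\<bar>t - \<tau>\<bar> \<le> d (point_of R (OnEdge e \<tau>)) (P i \<eta>)"
      using interior_neighbourhood[OF e _ _ T.in_space[OF i \<eta>i(2)]] by metis
    then show ?thesis using le by (intro bexI[of _ t]) auto
  qed
  then obtain t where t: "\<And>i. i \<in> A \<Longrightarrow> t i \<in> {0..len e}"
    "\<And>i. i \<in> A \<Longrightarrow> P i \<eta> = point_of R (OnEdge e (t i))" "\<And>i. i \<in> A \<Longrightarrow> \<bar>t i - \<tau>\<bar> \<le> \<eta>"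
    by metis
  have far: "2 * \<eta> \<le> \<bar>t i - t j\<bar>" if "i \<in> A" "j \<in> A" "i \<noteq> j" for i j
    using T.tripod[OF that, of \<eta>] \<eta>_len[of i] \<eta>_len[of j] edge_dist_le[OF e, of "t i" "t j"] t that \<eta>
    by simp
  \<comment> \<open>The outer two of three such parameters would be at least
    \<open>4 * \<eta>\<close> apart inside an interval of length \<open>2 * \<eta>\<close>.\<close>
  obtain i j m where "A = {i, j, m}" "i \<noteq> j" "i \<noteq> m" "j \<noteq> m"
    using A by (auto simp: card_3_iff)
  then show False
    using far[of i j] far[of i m] far[of j m] t(3)[of i] t(3)[of j] t(3)[of m] \<eta>(1) by auto
qed

theorem theorem1p3:
  fixes V :: "'v set" and E :: "'e set" and len :: "'e \<Rightarrow> real"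
    and R :: "('v, 'e) site rel"
    and d :: "('v, 'e) site set \<Rightarrow> ('v, 'e) site set \<Rightarrow> real"
  assumes "metric_graph V E len R d"
    and "contains_theta (graph_points V E len R) d"
    and "\<And>e. e \<in> E \<Longrightarrow> len e \<ge> 1"
  shows "\<exists>Blue Red. Blue \<subseteq> graph_points V E len R \<and> Red \<subseteq> graph_points V E len R \<and>
    card Blue = 3 \<and> card Red = 3 \<and>
    sum_pairs d Red + sum_pairs d Blue - (\<Sum>x\<in>Red. \<Sum>y\<in>Blue. d x y) \<ge> 1 / 12"
proof -
  interpret G: metric_graph V E len R d by fact
  interpret Metric_space "graph_points V E len R" d by (rule G.metric)
  obtain A :: "nat set" and l P where A: "card A = 3"
    and arcs: "parallel_arcs (graph_points V E len R) d A l P"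
    using contains_theta_parallel_arcs[OF assms(2)] .
  interpret T: parallel_arcs "graph_points V E len R" d A l P by (rule arcs)
  have fin: "finite A" using A by (simp add: card_ge_0_finite)
  have "A \<noteq> {}" using A by auto
  then obtain i where i: "i \<in> A" and min: "\<And>x. x \<in> A \<Longrightarrow> l i \<le> l x"
    using arg_min_if_finite[OF fin, of l] by (metis not_less)
  have "card (A - {i}) = 2" using A i fin by simp
  then obtain j k where jk: "A - {i} = {j, k}" "j \<noteq> k" by (auto simp: card_2_iff)
  obtain v where v: "v \<in> V" "P i 0 = point_of R (Vertex v)"
    using G.branch_point_vertex[OF arcs A i] .
  \<comment> \<open>The other branch point is the start of the reversed arcs.\<close>
  obtain w where w: "w \<in> V" "P i (l i) = point_of R (Vertex w)"
    using G.branch_point_vertex[OF T.reverse A i] by auto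
  have "v \<noteq> w" using T.start_neq_end[OF fin i] v w by auto
  then have "1 \<le> d (P i 0) (P i (l i))"
    using G.vertex_dist_ge[of 1] assms(3) v w by simp
  also have "\<dots> \<le> l i" using T.arc_dist_le[OF i, of 0 "l i"] T.len_pos[OF i] by simp
  \<comment> \<open>The shortest arc joins two distinct vertices, so \<open>l i / 4\<close> is in
    fact at least \<open>1 / 4\<close>.\<close>
  finally have "1 / 12 \<le> l i / 4" by simp
  moreover have "j \<in> A" "k \<in> A" "i \<noteq> j" "i \<noteq> k" using jk(1) by auto
  ultimately show ?thesis
    using T.six_points[OF i, of j k] jk(2) min by (meson order_trans)
qed

end
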